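(* Let $x_1,x_2,\dots$ be independent identically distributed random variables in $[0,1]$ with common probability density $f$ such that $f(x)\to c$ as $x\to0^+$ for some $c>0$ (the case $\alpha=1$). Let $H_n$ be the harmonic mean of $x_1,\dots,x_n$, let $X_n=1/H_n$, let $G$ be the limiting distribution function (of exponent $\alpha=1$) of the variables $Y_n=X_n-c\log n$, and let $\mathfrak C_1=1/c$. Then the random variable $\log n\,(H_n\log n-\mathfrak C_1)$ converges in distribution to a variable with distribution function $x\mapsto 1-G(-x/\mathfrak C_1^2)$.
   Context: The harmonic mean is given by $\frac1{H_n}=X_n=\frac1n\sum_{i=1}^n\frac1{x_i}$. The distribution $G$ is an unbalanced stable law of exponent $1$: a stable law of exponent $1$ is a nondegenerate limit in distribution of $n^{-1}S_n-b_n$ for some real constants $b_n$ and partial sums $S_n$ of i.i.d. random variables, and here unbalanced means that $x(1-G(x))$ tends to a positive constant and $xG(-x)\to0$ as $x\to+\infty$. *)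

theory Defs
  imports "HOL-Probability.Probability"
begin

definition reciprocal_mean :: "(nat \<Rightarrow> 'a \<Rightarrow> real) \<Rightarrow> nat \<Rightarrow> 'a \<Rightarrow> real" where
  "reciprocal_mean x n \<omega> = (1 / real n) * (\<Sum>i = 1..n. 1 / x i \<omega>)"

definition harmonic_mean :: "(nat \<Rightarrow> 'a \<Rightarrow> real) \<Rightarrow> nat \<Rightarrow> 'a \<Rightarrow> real" where
  "harmonic_mean x n \<omega> = 1 / reciprocal_mean x n \<omega>"

text \<open>The i.i.d. sequence in the definition of a stable law may live on any probability space. Every
  such sequence of real random variables can be realised on the sequence space, so quantifying over
  probability measures on \<^typ>\<open>nat \<Rightarrow> real\<close> loses nothing.\<close>

definition stable_law_exponent_1 :: "real measure \<Rightarrow> bool" where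
  "stable_law_exponent_1 G \<longleftrightarrow>
     real_distribution G \<and>
     (\<nexists>a. AE x in G. x = a) \<and>
     (\<exists>(M :: (nat \<Rightarrow> real) measure) (Z :: nat \<Rightarrow> (nat \<Rightarrow> real) \<Rightarrow> real) (b :: nat \<Rightarrow> real).
        prob_space M \<and>
        prob_space.indep_vars M (\<lambda>_. borel) Z {1..} \<and>
        (\<forall>i\<ge>1. distr M borel (Z i) = distr M borel (Z 1)) \<and>
        weak_conv_m (\<lambda>n. distr M borel (\<lambda>\<omega>. (\<Sum>i = 1..n. Z i \<omega>) / real n - b n)) G)"

definition unbalanced :: "real measure \<Rightarrow> bool" where
  "unbalanced G \<longleftrightarrow>
     (\<exists>a>0. ((\<lambda>x. x * (1 - cdf G x)) \<longlongrightarrow> a) at_top) \<and>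
     ((\<lambda>x. x * cdf G (- x)) \<longlongrightarrow> 0) at_top"

end

(* Y n converges to G by hypothesis, and H_n is a function of Y n: with L = ln n,
   L (H_n L - 1/c) = - Y n / (c (c + Y n / L)), so continuous mapping gives the limit - Y / c^2
   for Y distributed as G.  Its distribution function is 1 - G(- c^2 t) only where G has no atom.
   To exclude atoms, let phi be the characteristic function of G.  Exponent 1 forces
   |phi(kt)| = |phi(t)|^k, so |phi(t)| = exp(- l |t|) by continuity, with l > 0 as G is nondegenerate;
   thus phi is integrable, and Levy inversion bounds G(a, b] by a multiple of b - a. *)

theory Submission
  imports Defs
begin

section \<open>Integrable characteristic functions exclude atoms\<close>

text \<open>The kernel in Levy inversion has modulus at most b - a, so integrability bounds all
  truncated integrals at once. Intervals whose endpoints are not atoms thus have mass at most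
  \<open>(b - a) * K\<close>, and such intervals shrink to x.\<close>

lemma (in real_distribution) measure_singleton_eq_0_if_integrable_char:
  assumes int: "integrable lborel (char M)"
  shows "measure M {x} = 0"
proof -
  define K where "K = (LINT t|lborel. cmod (char M t))"
  have K0: "K \<ge> 0" unfolding K_def by simp
  have bound: "measure M {a<..b} \<le> (b - a) * K"
    if ab: "a \<le> b" and at: "measure M {a} = 0" "measure M {b} = 0" for a b
  proof -
    let ?g = "\<lambda>t. (iexp (-(t * a)) - iexp (-(t * b))) / (\<i> * t) * char M t"
    have gb: "cmod (?g t) \<le> (b - a) * cmod (char M t)" for t :: real
    proof (cases "t = 0")
      case False
      \<comment> \<open>The library bound is used with upper endpoint -a and lower endpoint -b. At t
        = 0 the quotient is 0 by the convention on division.\<close>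
      have "cmod ((iexp (t * - a) - iexp (t * - b)) / (\<i> * t)) \<le> - a - - b"
        using ab False by (intro Levy_Inversion_aux2) auto
      then show ?thesis
        unfolding norm_mult by (intro mult_right_mono) auto
    qed (use ab in auto)
    have intg: "integrable lborel (\<lambda>t. (b - a) * cmod (char M t))"
      using int by auto
    have le: "cmod (1 / (2 * pi) * (CLBINT t=-real n..real n. ?g t)) \<le> (b - a) * K" for n
    proof -
      let ?h = "\<lambda>t. indicator (einterval (-real n) (real n)) t *\<^sub>R ?g t"
      have hb: "cmod (?h t) \<le> (b - a) * cmod (char M t)" for t
        using gb[of t] ab by (auto split: split_indicator)
      have "integrable lborel ?h"
      proof (rule Bochner_Integration.integrable_bound[OF intg])
        show "?h \<in> borel_measurable lborel" by measurable
      qed (use hb ab in auto)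
      then have "cmod (CLBINT t. ?h t) \<le> (LINT t|lborel. (b - a) * cmod (char M t))"
        using intg hb by (intro Bochner_Integration.integral_norm_bound_integral) auto
      then have "cmod (CLBINT t=-real n..real n. ?g t) \<le> (b - a) * K"
        by (simp add: interval_lebesgue_integral_def set_lebesgue_integral_def K_def)
      moreover have "cmod (1 / (2 * pi)) \<le> 1"
        using pi_ge_two by (simp add: norm_divide norm_mult)
      ultimately show ?thesis
        unfolding norm_mult using mult_mono[of "cmod (1 / (2 * pi))" 1] ab K0 by fastforce
    qed
    have "cmod (complex_of_real (measure M {a<..b})) \<le> (b - a) * K"
      by (rule LIMSEQ_le_const2[OF tendsto_norm[OF Levy_Inversion[OF ab at]]]) (use le in auto)
    then show ?thesis by simp
  qed
  have small: "measure M {x} \<le> 2 * e * K" if "e > 0" for e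
  proof -
    \<comment> \<open>Atoms are countable, so on each side of x there is a point closer than e that
      inversion accepts as an endpoint.\<close>
    have cnt: "countable {x. measure M {x} \<noteq> 0}" by (rule countable_support)
    have "\<exists>a\<in>{x - e<..<x}. a \<notin> {x. measure M {x} \<noteq> 0}"
      using that by (intro open_minus_countable[OF cnt]) auto
    then obtain a where a: "x - e < a" "a < x" "measure M {a} = 0" by auto
    have "\<exists>b\<in>{x<..<x + e}. b \<notin> {x. measure M {x} \<noteq> 0}"
      using that by (intro open_minus_countable[OF cnt]) auto
    then obtain b where b: "x < b" "b < x + e" "measure M {b} = 0" by auto
    have "measure M {x} \<le> measure M {a<..b}"
      using a b by (intro finite_measure_mono) auto
    also have "\<dots> \<le> (b - a) * K" using a b by (intro bound) auto
    also have "\<dots> \<le> 2 * e * K" using a b K0 by (intro mult_right_mono) auto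
    finally show ?thesis .
  qed
  have "((\<lambda>e. 2 * e * K) \<longlongrightarrow> 0) (at_right 0)"
    by (auto intro!: tendsto_eq_intros)
  moreover have "\<forall>\<^sub>F e in at_right 0. measure M {x} \<le> 2 * e * K"
    using small by (auto simp: eventually_at_right_less intro: eventually_at_rightI[of 0 1])
  ultimately have "measure M {x} \<le> 0"
    by (rule tendsto_lowerbound) simp
  then show ?thesis by (simp add: measure_le_0_iff)
qed

lemma integrable_exp_neg_abs:
  fixes l :: real
  assumes "l > 0"
  shows "integrable lborel (\<lambda>t. exp (- l * \<bar>t\<bar>))"
proof -
  interpret prob_space "density lborel (exponential_density l)"
    using assms by (rule prob_space_exponential_density)
  have "integrable (density lborel (exponential_density l)) (\<lambda>_. 1 :: real)"
    by simp
  then have i: "integrable lborel (exponential_density l)"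
    using assms by (subst (asm) integrable_density) (auto simp: exponential_density_nonneg)
  then have i': "integrable lborel (\<lambda>t. exponential_density l (- t))"
    using lborel_integrable_real_affine[of "exponential_density l" "-1" 0] by simp
  show ?thesis
  \<comment> \<open>The density and its mirror image add up to
    \<open>l * exp (- l * \<bar>t\<bar>)\<close> except at t = 0, where both contribute; hence
    domination instead of equality.\<close>
  proof (rule Bochner_Integration.integrable_bound)
    show "integrable lborel
        (\<lambda>t. (exponential_density l t + exponential_density l (- t)) / l)"
      using i i' by auto
  qed (use assms in \<open>auto simp: exponential_density_def field_simps\<close>)
qed

section \<open>Modulus of characteristic functions and degenerate laws\<close>

lemma char_distr_affine:
  assumes [measurable]: "X \<in> borel_measurable M"
  shows "char (distr M borel (\<lambda>\<omega>. X \<omega> / r - b)) t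
    = iexp (- (t * b)) * char (distr M borel X) (t / r)"
proof -
  have "char (distr M borel (\<lambda>\<omega>. X \<omega> / r - b)) t = (CLINT \<omega>|M. iexp (t * (X \<omega> / r - b)))"
    unfolding char_def by (subst integral_distr) auto
  also have "\<dots> = (CLINT \<omega>|M. iexp (- (t * b)) * iexp (t / r * X \<omega>))"
    by (simp add: exp_add[symmetric] algebra_simps)
  also have "\<dots> = iexp (- (t * b)) * (CLINT \<omega>|M. iexp (t / r * X \<omega>))"
    by (rule integral_mult_right_zero)
  also have "(CLINT \<omega>|M. iexp (t / r * X \<omega>)) = char (distr M borel X) (t / r)"
    unfolding char_def by (subst integral_distr) auto
  finally show ?thesis .
qed

lemma cmod_char_minus: "cmod (char M (- t)) = cmod (char M t)"
proof -
  have "char M (- t) = (CLINT x|M. cnj (iexp (t * x)))"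
    unfolding char_def by (simp add: exp_cnj)
  also have "\<dots> = cnj (char M t)"
    unfolding char_def by simp
  finally show ?thesis by simp
qed

text \<open>Equality case of the bound by 1: after rotation by the argument of
  \<open>char M t\<close>, the mean of a cosine is 1, and a cosine never exceeds 1. For nonzero t
  this puts the law on a lattice of spacing 2 pi / |t|.\<close>

lemma (in real_distribution) AE_lattice_if_cmod_char_eq_1:
  assumes "cmod (char M t) = 1"
  shows "\<exists>\<theta>. AE x in M. cos (t * x - \<theta>) = 1"
proof -
  obtain \<theta> where \<theta>: "char M t = iexp \<theta>"
    using assms complex_unit_circle by (metis cis_conv_exp complex_norm_eq_1_exp)
  have int: "integrable M (\<lambda>x. iexp (t * x - \<theta>))"
    by (rule integrable_const_bound[of _ 1]) auto
  have "(CLINT x|M. iexp (t * x - \<theta>)) = (CLINT x|M. iexp (- \<theta>) * iexp (t * x))"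
    by (simp add: exp_add[symmetric] algebra_simps)
  also have "\<dots> = iexp (- \<theta>) * char M t"
    unfolding char_def by (rule integral_mult_right_zero)
  also have "\<dots> = 1"
    unfolding \<theta> by (simp add: exp_add[symmetric])
  finally have "(LINT x|M. Re (iexp (t * x - \<theta>))) = 1"
    using int by (subst integral_Re) auto
  then have "(LINT x|M. cos (t * x - \<theta>)) = 1" 
    by (simp add: Re_exp)
  moreover have ic: "integrable M (\<lambda>x. cos (t * x - \<theta>))"
    by (rule integrable_const_bound[of _ 1]) auto
  ultimately have "(LINT x|M. 1 - cos (t * x - \<theta>)) = 0"
    using prob_space by (subst Bochner_Integration.integral_diff) auto
  then have "AE x in M. 1 - cos (t * x - \<theta>) = 0"
    using ic by (subst (asm) integral_nonneg_eq_0_iff_AE) auto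
  then show ?thesis by auto
qed

text \<open>The frequencies 1/(n+1) give lattices of spacing 2 pi (n+1). Two points lying together
  in all of these lattices must coincide, as the spacing is unbounded.\<close>

lemma (in real_distribution) AE_const_if_cmod_char_eq_1:
  assumes "\<And>t. cmod (char M t) = 1"
  shows "\<exists>a. AE x in M. x = a"
proof -
  have "\<exists>\<theta>. AE x in M. cos (1 / real (Suc n) * x - \<theta>) = 1" for n
    using assms by (rule AE_lattice_if_cmod_char_eq_1)
  then obtain \<theta> where "\<And>n. AE x in M. cos (1 / real (Suc n) * x - \<theta> n) = 1"
    by metis
  then have ae: "AE x in M. \<forall>n. cos (1 / real (Suc n) * x - \<theta> n) = 1"
    by (simp add: AE_all_countable)
  \<comment> \<open>An almost sure event of a probability measure is nonempty; any of its points
    serves as the constant.\<close>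
  obtain a where a: "\<And>n. cos (1 / real (Suc n) * a - \<theta> n) = 1"
    using eventually_happens[OF ae] by (auto simp: trivial_limit_def AE_False)
  have "x = a" if x: "\<forall>n. cos (1 / real (Suc n) * x - \<theta> n) = 1" for x
  proof -
    \<comment> \<open>This n makes the spacing exceed the distance from x to a, so both are the same
      lattice point.\<close>
    obtain n :: nat where n: "\<bar>x - a\<bar> < n" using reals_Archimedean2 by blast
    obtain i j :: int where
      "1 / real (Suc n) * x - \<theta> n = of_int i * 2 * pi"
      "1 / real (Suc n) * a - \<theta> n = of_int j * 2 * pi"
      using x a[of n] unfolding cos_one_2pi_int by blast
    then have e: "x - a = real (Suc n) * (2 * pi * of_int (i - j))"
      by (simp add: field_simps)
    have "i = j"
    proof (rule ccontr)
      assume "i \<noteq> j"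
      then have "1 \<le> \<bar>of_int (i - j) :: real\<bar>"
        by linarith
      moreover have "1 \<le> 2 * pi" using pi_ge_two by linarith
      ultimately have "1 * 1 \<le> (2 * pi) * \<bar>of_int (i - j)\<bar>"
        by (intro mult_mono) auto
      then have "real (Suc n) * 1 \<le> real (Suc n) * (2 * pi * \<bar>of_int (i - j)\<bar>)"
        by (intro mult_left_mono) auto
      also have "\<dots> = \<bar>x - a\<bar>"
        unfolding e by (simp add: abs_mult)
      finally show False using n by simp
    qed
    then show ?thesis using e by simp
  qed
  then show ?thesis using ae by (intro exI[of _ a]) (auto elim!: eventually_mono)
qed

section \<open>Exponential decay of the characteristic function of a stable law of exponent
  1\<close>

text \<open>Taking roots turns integer homogeneity into rational homogeneity, and continuity passes
  to real u. Positivity of h is what allows roots and real powers.\<close>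

lemma eq_powr_if_power_homogeneous:
  fixes h :: "real \<Rightarrow> real"
  assumes cont: "\<And>t. isCont h t" and h0: "h 0 = 1" and nonneg: "\<And>t. 0 \<le> h t"
    and hom: "\<And>k t. k > 0 \<Longrightarrow> h (real k * t) = h t ^ k"
    and u: "u > 0"
  shows "h s > 0" and "h (u * s) = h s powr u"
proof -
  show pos: "h s > 0" for s
  proof (rule ccontr)
    assume "\<not> h s > 0"
    then have "h s = 0" using nonneg[of s] by simp
    \<comment> \<open>A zero at s forces zeros at all s/(k+1), which accumulate at 0, where h is
      1.\<close>
    then have "h (s / real (Suc k)) = 0" for k
      using hom[of "Suc k" "s / real (Suc k)"] by (auto simp del: of_nat_Suc)
    moreover have "(\<lambda>k. s / real (Suc k)) \<longlonglongrightarrow> 0"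
      by (rule LIMSEQ_Suc[OF lim_const_over_n])
    then have "(\<lambda>k. h (s / real (Suc k))) \<longlonglongrightarrow> h 0"
      using cont isCont_tendsto_compose by blast
    ultimately show False using h0 by (simp add: LIMSEQ_const_iff)
  qed
  have rat: "h (real p / real q * s) = h s powr (real p / real q)" if "p > 0" "q > 0" for p q
  proof -
    have "h (real p / real q * s) ^ q = h (real q * (real p / real q * s))"
      using that by (simp only: hom)
    also have "\<dots> = h (real p * s)" using that by simp
    also have "\<dots> = h s powr real p" using that pos by (simp only: hom powr_realpow)
    finally have "(h (real p / real q * s) powr real q) powr (1 / real q)
        = (h s powr real p) powr (1 / real q)"
      using pos by (simp add: powr_realpow)
    then show ?thesis using pos[of "real p / real q * s"] that by (simp add: powr_powr)
  qed
  \<comment> \<open>Rounding up keeps the numerator positive, as \<open>rat\<close> requires, and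
    the fraction p n / (n+1) exceeds u by at most 1/(n+1).\<close>
  define p where "p n = nat \<lceil>u * real (Suc n)\<rceil>" for n
  have ppos: "p n > 0" for n
    using u by (simp add: p_def)
  have lim: "(\<lambda>n. real (p n) / real (Suc n)) \<longlonglongrightarrow> u"
  proof (rule tendsto_sandwich)
    show "\<forall>\<^sub>F n in sequentially. u \<le> real (p n) / real (Suc n)"
      using u by (intro always_eventually allI) (simp add: p_def pos_le_divide_eq del: of_nat_Suc)
    show "\<forall>\<^sub>F n in sequentially. real (p n) / real (Suc n) \<le> u + 1 / real (Suc n)"
    proof (intro always_eventually allI)
      fix n
      have "real (p n) \<le> u * real (Suc n) + 1"
        using u unfolding p_def by (simp del: of_nat_Suc)
      then have "real (p n) / real (Suc n) \<le> (u * real (Suc n) + 1) / real (Suc n)"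
        by (intro divide_right_mono) auto
      then show "real (p n) / real (Suc n) \<le> u + 1 / real (Suc n)"
        by (simp add: add_divide_distrib del: of_nat_Suc)
    qed
    show "(\<lambda>n. u + 1 / real (Suc n)) \<longlonglongrightarrow> u"
      using tendsto_add[OF tendsto_const LIMSEQ_Suc[OF lim_const_over_n[of 1]], of u] by simp
  qed simp
  have "(\<lambda>n. h (real (p n) / real (Suc n) * s)) \<longlonglongrightarrow> h (u * s)"
    by (intro isCont_tendsto_compose[OF cont] tendsto_mult lim tendsto_const)
  moreover have "(\<lambda>n. h (real (p n) / real (Suc n) * s)) \<longlonglongrightarrow> h s powr u"
    unfolding rat[OF ppos zero_less_Suc] using pos[of s]
    by (intro tendsto_powr lim tendsto_const) auto
  ultimately show "h (u * s) = h s powr u" by (rule LIMSEQ_unique)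
qed

text \<open>Passing to the modulus removes the centring constants \<open>b\<^sub>n\<close>, so the scaling relation
  \<open>\<bar>\<phi>(kt)\<bar> = \<bar>\<phi>(t)\<bar>\<^sup>k\<close> is read off the subsequence \<open>kn\<close> without a convergence of types theorem.\<close>

lemma cmod_char_stable_law_exponent_1:
  assumes st: "stable_law_exponent_1 G" and k: "k > 0"
  shows "cmod (char G (real k * t)) = cmod (char G t) ^ k"
proof -
  obtain M :: "(nat \<Rightarrow> real) measure" and Z :: "nat \<Rightarrow> (nat \<Rightarrow> real) \<Rightarrow> real" and b
    where M: "prob_space M" and G: "real_distribution G"
      and ind: "prob_space.indep_vars M (\<lambda>_. borel) Z {1..}"
      and id: "\<And>i. i \<ge> 1 \<Longrightarrow> distr M borel (Z i) = distr M borel (Z 1)"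
      and wc: "weak_conv_m (\<lambda>n. distr M borel (\<lambda>\<omega>. (\<Sum>i = 1..n. Z i \<omega>) / real n - b n)) G"
    using st unfolding stable_law_exponent_1_def by blast
  interpret prob_space M by fact
  have Zm: "Z i \<in> borel_measurable M" if "i \<ge> 1" for i
    using ind that unfolding indep_vars_def by auto
  let ?S = "\<lambda>n \<omega>. \<Sum>i = 1..n. Z i \<omega>"
  have Sm [measurable]: "?S n \<in> borel_measurable M" for n
    using Zm by (intro borel_measurable_sum) auto
  let ?\<psi> = "char (distr M borel (Z 1))"
  have S: "cmod (char (distr M borel (\<lambda>\<omega>. ?S n \<omega> / real n - b n)) t) = cmod (?\<psi> (t / real n)) ^ n"
    for n t
  proof -
    have "char (distr M borel (?S n)) (t / real n)
        = (\<Prod>i\<in>{1..n}. char (distr M borel (Z i)) (t / real n))"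
      by (rule char_distr_sum, rule indep_vars_subset[OF ind]) auto
    also have "\<dots> = (\<Prod>i\<in>{1..n}. ?\<psi> (t / real n))"
      by (intro prod.cong refl arg_cong2[where f = char] id) auto
    also have "\<dots> = ?\<psi> (t / real n) ^ n"
      by simp
    finally show ?thesis
      unfolding char_distr_affine[OF Sm] norm_mult by (simp add: norm_power)
  qed
  have lim: "(\<lambda>n. cmod (?\<psi> (t / real n)) ^ n) \<longlonglongrightarrow> cmod (char G t)" for t
  proof -
    have "(\<lambda>n. char (distr M borel (\<lambda>\<omega>. ?S n \<omega> / real n - b n)) t) \<longlonglongrightarrow> char G t"
      by (intro levy_continuity1 wc G real_distribution_distr) measurable
    then show ?thesis unfolding S[symmetric] by (rule tendsto_norm)
  qed
  have "(\<lambda>n. cmod (?\<psi> (real k * t / real (n * k))) ^ (n * k)) \<longlonglongrightarrow> cmod (char G (real k * t))"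
    using filterlim_compose[OF lim[of "real k * t"] mult_nat_right_at_top[OF k]] .
  \<comment> \<open>As kt/(nk) = t/n, the term of index nk at kt is the k-th power of the term of
    index n at t.\<close>
  moreover have "cmod (?\<psi> (real k * t / real (n * k))) ^ (n * k)
      = (cmod (?\<psi> (t / real n)) ^ n) ^ k" for n
    using k by (simp add: power_mult)
  ultimately have "(\<lambda>n. (cmod (?\<psi> (t / real n)) ^ n) ^ k) \<longlonglongrightarrow> cmod (char G (real k * t))"
    by (simp only:)
  moreover have "(\<lambda>n. (cmod (?\<psi> (t / real n)) ^ n) ^ k) \<longlonglongrightarrow> cmod (char G t) ^ k"
    by (intro tendsto_power lim)
  ultimately show ?thesis by (rule LIMSEQ_unique)
qed

text \<open>Makes open and closed half-lines equally likely under G, as needed when the limit law is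
  reflected.\<close>

lemma stable_law_exponent_1_measure_singleton:
  assumes st: "stable_law_exponent_1 G"
  shows "measure G {a} = 0"
proof -
  interpret real_distribution G
    using st unfolding stable_law_exponent_1_def by blast
  let ?h = "\<lambda>t. cmod (char G t)"
  \<comment> \<open>Nondegeneracy enters here: modulus 1 at every frequency would make G a point
    mass.\<close>
  have "\<exists>t. ?h t \<noteq> 1"
    using st AE_const_if_cmod_char_eq_1 unfolding stable_law_exponent_1_def by blast
  then obtain t where t: "?h t \<noteq> 1" by blast
  then have t0: "t \<noteq> 0" using char_zero by auto
  define s where "s = \<bar>t\<bar>"
  have s: "s > 0" using t0 by (simp add: s_def)
  have habs: "?h \<bar>r\<bar> = ?h r" for r
    using cmod_char_minus[of G r] by (simp add: abs_if)
  have hs: "?h s < 1"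
    using t cmod_char_le_1[of t] unfolding s_def habs by simp
  have powr: "?h s > 0" "?h (u * s) = ?h s powr u" if "u > 0" for u
    using that eq_powr_if_power_homogeneous[of ?h u s] cmod_char_stable_law_exponent_1[OF st]
    by (auto simp: isCont_char char_zero)
  \<comment> \<open>The rate for which \<open>?h s\<close> equals exp(-l s); it is positive because
    \<open>?h s\<close> lies strictly between 0 and 1.\<close>
  define l where "l = - ln (?h s) / s"
  have l: "l > 0"
    using s hs powr(1)[of 1] by (simp add: l_def divide_neg_pos)
  have h: "?h r \<le> exp (- l * \<bar>r\<bar>)" for r
  proof (cases "r = 0")
    case False
    then have "?h r = ?h s powr (\<bar>r\<bar> / s)"
      using powr(2)[of "\<bar>r\<bar> / s"] s habs[of r] by simp
    also have "\<dots> = exp (- l * \<bar>r\<bar>)"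
      using powr(1)[of 1] by (auto simp: powr_def l_def field_simps)
    finally show ?thesis by simp
  qed (simp add: char_zero)
  have "integrable lborel (char G)"
    by (rule Bochner_Integration.integrable_bound[OF integrable_exp_neg_abs[OF l]])
      (use h in auto)
  then show ?thesis by (rule measure_singleton_eq_0_if_integrable_char)
qed

section \<open>Continuous mapping and the passage to the harmonic mean\<close>

text \<open>Continuous mapping for maps that vary with n. A Skorohod coupling replaces weak by
  pointwise convergence, so \<open>lim\<close> applies to each outcome; dominated convergence then
  handles bounded continuous test functions.\<close>

lemma weak_conv_m_distr_if_continuously_convergent:
  fixes \<mu> :: "nat \<Rightarrow> real measure" and g :: "nat \<Rightarrow> real \<Rightarrow> real"
  assumes \<mu>: "\<And>n. real_distribution (\<mu> n)" and \<nu>: "real_distribution \<nu>"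
    and wc: "weak_conv_m \<mu> \<nu>"
    and [measurable]: "\<And>n. g n \<in> borel_measurable borel" "g' \<in> borel_measurable borel"
    and lim: "\<And>y l. y \<longlonglongrightarrow> l \<Longrightarrow> (\<lambda>n. g n (y n)) \<longlonglongrightarrow> g' l"
  shows "weak_conv_m (\<lambda>n. distr (\<mu> n) borel (g n)) (distr \<nu> borel g')"
proof -
  obtain \<Omega> :: "real measure" and Y :: "nat \<Rightarrow> real \<Rightarrow> real" and Y' :: "real \<Rightarrow> real"
    where \<Omega>: "prob_space \<Omega>"
      and [measurable]: "\<And>n. Y n \<in> borel_measurable \<Omega>" and Y': "Y' \<in> measurable \<Omega> lborel"
      and dY: "\<And>n. distr \<Omega> borel (Y n) = \<mu> n" and dY': "distr \<Omega> borel Y' = \<nu>"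
      and YY: "\<And>\<omega>. \<omega> \<in> space \<Omega> \<Longrightarrow> (\<lambda>n. Y n \<omega>) \<longlonglongrightarrow> Y' \<omega>"
    using Skorohod[OF \<mu> \<nu> wc] by blast
  have [measurable]: "Y' \<in> borel_measurable \<Omega>" using Y' by simp
  interpret prob_space \<Omega> by fact
  have d: "distr (\<mu> n) borel (g n) = distr \<Omega> borel (\<lambda>\<omega>. g n (Y n \<omega>))" for n
    unfolding dY[symmetric] by (subst distr_distr) (auto simp: comp_def)
  have d': "distr \<nu> borel g' = distr \<Omega> borel (\<lambda>\<omega>. g' (Y' \<omega>))"
    unfolding dY'[symmetric] by (subst distr_distr) (auto simp: comp_def)
  show ?thesis
    unfolding d d'
  proof (rule integral_bdd_continuous_conv_imp_weak_conv)
    fix f :: "real \<Rightarrow> real"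
    assume cont: "\<And>x. isCont f x" and bd: "\<And>x. \<bar>f x\<bar> \<le> 1"
    have [measurable]: "f \<in> borel_measurable borel"
      using cont by (intro borel_measurable_continuous_onI) (simp add: continuous_at_imp_continuous_on)
    have "(\<lambda>n. LINT \<omega>|\<Omega>. f (g n (Y n \<omega>))) \<longlonglongrightarrow> (LINT \<omega>|\<Omega>. f (g' (Y' \<omega>)))"
    proof (rule integral_dominated_convergence[where w = "\<lambda>_. 1"])
      show "AE \<omega> in \<Omega>. (\<lambda>n. f (g n (Y n \<omega>))) \<longlonglongrightarrow> f (g' (Y' \<omega>))"
        using YY lim by (intro AE_I2 isCont_tendsto_compose[OF cont]) auto
    qed (use bd in auto)
    then show "(\<lambda>n. integral\<^sup>L (distr \<Omega> borel (\<lambda>\<omega>. g n (Y n \<omega>))) f)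
        \<longlonglongrightarrow> integral\<^sup>L (distr \<Omega> borel (\<lambda>\<omega>. g' (Y' \<omega>))) f"
      by (simp add: integral_distr)
  qed (auto intro!: real_distribution_distr)
qed

text \<open>With L = ln n, the expression is -y/(c (y/L + c)) once the denominators are positive,
  and y/L tends to 0.\<close>

lemma tendsto_ln_times_reciprocal_deviation:
  fixes c :: real
  assumes c: "c > 0" and y: "y \<longlonglongrightarrow> l"
  shows "(\<lambda>n. ln (real n) * (1 / (y n + c * ln (real n)) * ln (real n) - 1 / c)) \<longlonglongrightarrow> - l / c\<^sup>2"
proof -
  have L: "filterlim (\<lambda>n. ln (real n)) at_top sequentially"
    by (rule filterlim_compose[OF ln_at_top filterlim_real_sequentially])
  have z: "(\<lambda>n. y n / ln (real n)) \<longlonglongrightarrow> 0"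
    by (rule real_tendsto_divide_at_top[OF y L])
  then have zc: "(\<lambda>n. y n / ln (real n) + c) \<longlonglongrightarrow> c"
    using tendsto_add[OF z tendsto_const[of c]] by simp
  \<comment> \<open>The identity divides by ln n and by y n + c ln n, so it is claimed only for
    large n, where both are positive.\<close>
  have "\<forall>\<^sub>F n in sequentially. ln (real n) > 0"
    using L by (simp add: filterlim_at_top_dense)
  moreover have "\<forall>\<^sub>F n in sequentially. y n / ln (real n) + c > 0"
    using zc c by (rule order_tendstoD)
  ultimately have "\<forall>\<^sub>F n in sequentially. - y n / (c * (y n / ln (real n) + c))
      = ln (real n) * (1 / (y n + c * ln (real n)) * ln (real n) - 1 / c)"
  proof eventually_elim
    case (elim n)
    let ?L = "ln (real n)"
    have "y n / ?L + c = (y n + c * ?L) / ?L"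
      using elim by (simp add: field_simps)
    moreover from this have "y n + c * ?L > 0"
      using elim by (simp add: zero_less_divide_iff)
    ultimately show ?case using elim(1) c by (simp add: field_simps)
  qed
  moreover have "(\<lambda>n. - y n / (c * (y n / ln (real n) + c))) \<longlonglongrightarrow> - l / (c * c)"
    using c by (intro tendsto_intros y zc) auto
  ultimately show ?thesis
    unfolding power2_eq_square by (rule Lim_transform_eventually[rotated])
qed

text \<open>Reflection turns a lower closed half-line into an upper closed one, whose complement
  omits its endpoint; without an atom there, the mass of that complement is a value of the
  cdf.\<close>

lemma (in real_distribution) cdf_distr_mult_neg:
  assumes k: "k > 0" and atom: "\<And>a. measure M {a} = 0"
  shows "cdf (distr M borel (\<lambda>y. - y / k)) t = 1 - cdf M (- t * k)"
proof -
  have "cdf (distr M borel (\<lambda>y. - y / k)) t = measure M {y. - y / k \<le> t}"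
    unfolding cdf_def by (subst measure_distr) (auto simp: vimage_def)
  also have "{y. - y / k \<le> t} = space M - {..<- t * k}"
    using k by (auto simp: field_simps)
  also have "measure M \<dots> = 1 - measure M {..<- t * k}"
    by (rule prob_compl) simp
  also have "measure M {..<- t * k} = cdf M (- t * k)"
  proof -
    have "cdf M (- t * k) = measure M ({..<- t * k} \<union> {- t * k})"
      unfolding cdf_def by (rule arg_cong[of _ _ "measure M"]) auto
    also have "\<dots> = measure M {..<- t * k} + measure M {- t * k}"
      by (rule finite_measure_Union) auto
    finally show ?thesis using atom by simp
  qed
  finally show ?thesis .
qed

theorem theoremJ:
  fixes M :: "'a measure" and x :: "nat \<Rightarrow> 'a \<Rightarrow> real"
    and f :: "real \<Rightarrow> real" and c C1 :: real and G :: "real measure"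
  assumes "prob_space M"
    and "prob_space.indep_vars M (\<lambda>_. borel) x {1..}"
    and "\<And>i \<omega>. i \<ge> 1 \<Longrightarrow> \<omega> \<in> space M \<Longrightarrow> x i \<omega> \<in> {0..1}"
    and "\<And>t. 0 \<le> f t"
    and "\<And>i. i \<ge> 1 \<Longrightarrow> distributed M lborel (x i) (\<lambda>t. ennreal (f t))"
    and "c > 0"
    and "(f \<longlongrightarrow> c) (at_right 0)"
    and "stable_law_exponent_1 G" and "unbalanced G"
    and "weak_conv_m (\<lambda>n. distr M borel (\<lambda>\<omega>. reciprocal_mean x n \<omega> - c * ln (real n))) G"
    and "C1 = 1 / c"
  shows "\<exists>N. real_distribution N \<and>
    cdf N = (\<lambda>t. 1 - cdf G (- t / C1\<^sup>2)) \<and>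
    weak_conv_m
      (\<lambda>n. distr M borel (\<lambda>\<omega>. ln (real n) * (harmonic_mean x n \<omega> * ln (real n) - C1))) N"
proof -
  interpret prob_space M by fact
  interpret G: real_distribution G
    using assms(8) unfolding stable_law_exponent_1_def by blast
  have xm: "x i \<in> borel_measurable M" if "i \<ge> 1" for i
    using assms(5)[OF that] distributed_measurable by fastforce
  have [measurable]: "reciprocal_mean x n \<in> borel_measurable M" for n
    unfolding reciprocal_mean_def[abs_def]
    by (intro borel_measurable_times borel_measurable_sum borel_measurable_divide xm) auto
  define Y where "Y n \<omega> = reciprocal_mean x n \<omega> - c * ln (real n)" for n \<omega>
  have [measurable]: "Y n \<in> borel_measurable M" for n
    unfolding Y_def[abs_def] by measurable
  \<comment> \<open>Adding c ln n to \<open>Y n\<close> recovers the reciprocal mean, so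
    \<open>g n\<close> maps \<open>Y n\<close> to the normalised deviation of the harmonic
    mean.\<close>
  define g where "g n y = ln (real n) * (1 / (y + c * ln (real n)) * ln (real n) - C1)"
    for n :: nat and y
  have [measurable]: "g n \<in> borel_measurable borel" for n
    unfolding g_def[abs_def] by measurable
  let ?N = "distr G borel (\<lambda>y. - y / c\<^sup>2)"
  have lim: "weak_conv_m (\<lambda>n. distr (distr M borel (Y n)) borel (g n)) ?N"
  proof (rule weak_conv_m_distr_if_continuously_convergent)
    show "weak_conv_m (\<lambda>n. distr M borel (Y n)) G"
      using assms(10) unfolding Y_def .
    show "(\<lambda>n. g n (y n)) \<longlonglongrightarrow> - l / c\<^sup>2" if "y \<longlonglongrightarrow> l" for y l
      unfolding g_def assms(11) using assms(6) that by (rule tendsto_ln_times_reciprocal_deviation)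
  qed (auto intro!: real_distribution_distr G.real_distribution_axioms)
  have "distr (distr M borel (Y n)) borel (g n)
      = distr M borel (\<lambda>\<omega>. ln (real n) * (harmonic_mean x n \<omega> * ln (real n) - C1))" for n
    by (subst distr_distr) (auto simp: comp_def g_def Y_def harmonic_mean_def)
  with lim have "weak_conv_m
      (\<lambda>n. distr M borel (\<lambda>\<omega>. ln (real n) * (harmonic_mean x n \<omega> * ln (real n) - C1))) ?N"
    by simp
  moreover have "cdf ?N = (\<lambda>t. 1 - cdf G (- t / C1\<^sup>2))"
  proof
    fix t
    \<comment> \<open>Multiplying by c^2 is dividing by the square of \<open>C1\<close>.\<close>
    have "cdf ?N t = 1 - cdf G (- t * c\<^sup>2)"
      using assms(6) stable_law_exponent_1_measure_singleton[OF assms(8)]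
      by (intro G.cdf_distr_mult_neg) auto
    then show "cdf ?N t = 1 - cdf G (- t / C1\<^sup>2)"
      by (simp add: assms(11) power_divide)
  qed
  moreover have "real_distribution ?N"
    by (intro G.real_distribution_distr) measurable
  ultimately show ?thesis by blast
qed

end
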